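(* Let $T$ be an algebraic $\sigma$-theory and $t(x,y)$ a $\sigma$-term which is a weak relative closure term for $T$, i.e. writing $u\le w$ for the equation $t(u,w)\approx w$, $\bar x:=t(x,y)$ and $X:=t(t(x,y),x)$, $T$ proves \begin{itemize} \item $t(\bar x,y)\le \bar x$, i.e. $t(t(t(x,y),y),t(x,y))\approx t(x,y)$ (Right-absorption); \item $t(\bar x,t(x,z))\approx t(\bar x,z)$ (Flattening); \item $t(t(X,\bar x),x)\le t(X,x)$ (Weak closure stability). \end{itemize} Let $M$ be a $T$-algebra. Then $M$ satisfies anti-symmetry (for all $a,b\in M$, $t(a,b)=b$ and $t(b,a)=a$ imply $a=b$) if and only if $M$ satisfies the equation $t(t(x,y),x)\approx t(t(t(x,y),x),y)$. Furthermore, if $M$ satisfies both $t(t(x,y),x)\approx t(t(t(x,y),x),y)$ and $y\le t(x,y)$ (i.e. $t(y,t(x,y))\approx t(x,y)$), then $M$ satisfies the Cornish condition $t(t(x,y),x)\approx t(t(y,x),y)$.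
   Context: A $T$-algebra is a set with interpretations of the symbols of $\sigma$ satisfying all equations of $T$ for all values of the variables. *)

theory Defs
  imports Main
begin

text \<open>
  A signature is a set of pairs of an operation symbol and its (finite) arity; constants have
  arity 0. The set may be empty. Variables are drawn from a countably infinite supply.
\<close>

type_synonym 'f signature = "('f \<times> nat) set"

datatype ('f, 'v) trm = Var 'v | Op 'f "('f, 'v) trm list"

type_synonym 'f eqn = "('f, nat) trm \<times> ('f, nat) trm"

primrec vars_of :: "('f, 'v) trm \<Rightarrow> 'v set" where
  "vars_of (Var v) = {v}"
| "vars_of (Op f ts) = \<Union> (set (map vars_of ts))"

inductive is_term :: "'f signature \<Rightarrow> ('f, 'v) trm \<Rightarrow> bool" for \<Sigma> where
  "is_term \<Sigma> (Var v)"
| "(f, length ts) \<in> \<Sigma> \<Longrightarrow> (\<And>s. s \<in> set ts \<Longrightarrow> is_term \<Sigma> s) \<Longrightarrow> is_term \<Sigma> (Op f ts)"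

primrec subst :: "('v \<Rightarrow> ('f, 'w) trm) \<Rightarrow> ('f, 'v) trm \<Rightarrow> ('f, 'w) trm" where
  "subst \<theta> (Var v) = \<theta> v"
| "subst \<theta> (Op f ts) = Op f (map (subst \<theta>) ts)"

definition algebraic_theory :: "'f signature \<Rightarrow> 'f eqn set \<Rightarrow> bool" where
  "algebraic_theory \<Sigma> T \<longleftrightarrow> (\<forall>(s, t) \<in> T. is_term \<Sigma> s \<and> is_term \<Sigma> t)"

text \<open>Derivability in (Birkhoff's) equational logic.\<close>

inductive proves :: "'f signature \<Rightarrow> 'f eqn set \<Rightarrow> 'f eqn \<Rightarrow> bool" for \<Sigma> T where
  axiom: "(s, t) \<in> T \<Longrightarrow> proves \<Sigma> T (s, t)"
| refl: "is_term \<Sigma> s \<Longrightarrow> proves \<Sigma> T (s, s)"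
| sym: "proves \<Sigma> T (s, t) \<Longrightarrow> proves \<Sigma> T (t, s)"
| trans: "proves \<Sigma> T (s, t) \<Longrightarrow> proves \<Sigma> T (t, u) \<Longrightarrow> proves \<Sigma> T (s, u)"
| cong: "(f, length ss) \<in> \<Sigma> \<Longrightarrow> length ts = length ss \<Longrightarrow>
    (\<And>i. i < length ss \<Longrightarrow> proves \<Sigma> T (ss ! i, ts ! i)) \<Longrightarrow> proves \<Sigma> T (Op f ss, Op f ts)"
| subst: "proves \<Sigma> T (s, t) \<Longrightarrow> (\<And>v. is_term \<Sigma> (\<theta> v)) \<Longrightarrow>
    proves \<Sigma> T (subst \<theta> s, subst \<theta> t)"

text \<open>The carrier of an algebra is an arbitrary set; it is allowed to be empty.\<close>

record ('f, 'a) algebra =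
  carrier :: "'a set"
  interp :: "'f \<Rightarrow> 'a list \<Rightarrow> 'a"

definition is_algebra :: "'f signature \<Rightarrow> ('f, 'a) algebra \<Rightarrow> bool" where
  "is_algebra \<Sigma> M \<longleftrightarrow> (\<forall>(f, n) \<in> \<Sigma>. \<forall>as. length as = n \<and> set as \<subseteq> carrier M \<longrightarrow>
     interp M f as \<in> carrier M)"

primrec eval_trm :: "('f, 'a) algebra \<Rightarrow> ('v \<Rightarrow> 'a) \<Rightarrow> ('f, 'v) trm \<Rightarrow> 'a" where
  "eval_trm M \<alpha> (Var v) = \<alpha> v"
| "eval_trm M \<alpha> (Op f ts) = interp M f (map (eval_trm M \<alpha>) ts)"

definition satisfies :: "('f, 'a) algebra \<Rightarrow> 'f eqn \<Rightarrow> bool" where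
  "satisfies M e \<longleftrightarrow>
     (\<forall>\<alpha>. (\<forall>v. \<alpha> v \<in> carrier M) \<longrightarrow> eval_trm M \<alpha> (fst e) = eval_trm M \<alpha> (snd e))"

definition theory_algebra :: "'f signature \<Rightarrow> 'f eqn set \<Rightarrow> ('f, 'a) algebra \<Rightarrow> bool" where
  "theory_algebra \<Sigma> T M \<longleftrightarrow> is_algebra \<Sigma> M \<and> (\<forall>e \<in> T. satisfies M e)"

text \<open>
  A term \<open>t(x, y)\<close> is a term whose variables are among the variables 0 and 1, which play the roles
  of its first and second argument. \<open>papp t u w\<close> is \<open>t(u, w)\<close> for terms \<open>u\<close>, \<open>w\<close>;
  \<open>op2 M t a b\<close> is \<open>t(a, b)\<close> for elements \<open>a\<close>, \<open>b\<close> of \<open>M\<close>.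
\<close>

definition binary_term :: "'f signature \<Rightarrow> ('f, nat) trm \<Rightarrow> bool" where
  "binary_term \<Sigma> t \<longleftrightarrow> is_term \<Sigma> t \<and> vars_of t \<subseteq> {0, 1}"

definition papp :: "('f, nat) trm \<Rightarrow> ('f, 'v) trm \<Rightarrow> ('f, 'v) trm \<Rightarrow> ('f, 'v) trm" where
  "papp t u w = subst (\<lambda>v. if v = 0 then u else w) t"

definition op2 :: "('f, 'a) algebra \<Rightarrow> ('f, nat) trm \<Rightarrow> 'a \<Rightarrow> 'a \<Rightarrow> 'a" where
  "op2 M t a b = eval_trm M (\<lambda>v. if v = 0 then a else b) t"

definition le_eqn :: "('f, nat) trm \<Rightarrow> ('f, nat) trm \<Rightarrow> ('f, nat) trm \<Rightarrow> 'f eqn" where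
  "le_eqn t u w = (papp t u w, w)"

abbreviation vx :: "('f, nat) trm" where "vx \<equiv> Var 0"
abbreviation vy :: "('f, nat) trm" where "vy \<equiv> Var 1"
abbreviation vz :: "('f, nat) trm" where "vz \<equiv> Var 2"

definition right_absorption :: "('f, nat) trm \<Rightarrow> 'f eqn" where
  "right_absorption t = (let xb = papp t vx vy in le_eqn t (papp t xb vy) xb)"

definition flattening :: "('f, nat) trm \<Rightarrow> 'f eqn" where
  "flattening t = (let xb = papp t vx vy in (papp t xb (papp t vx vz), papp t xb vz))"

definition weak_closure_stability :: "('f, nat) trm \<Rightarrow> 'f eqn" where
  "weak_closure_stability t =
     (let xb = papp t vx vy; X = papp t xb vx
      in le_eqn t (papp t (papp t X xb) vx) (papp t X vx))"

definition weak_relative_closure_term ::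
    "'f signature \<Rightarrow> 'f eqn set \<Rightarrow> ('f, nat) trm \<Rightarrow> bool" where
  "weak_relative_closure_term \<Sigma> T t \<longleftrightarrow>
     binary_term \<Sigma> t \<and>
     proves \<Sigma> T (right_absorption t) \<and>
     proves \<Sigma> T (flattening t) \<and>
     proves \<Sigma> T (weak_closure_stability t)"

definition antisymmetry :: "('f, 'a) algebra \<Rightarrow> ('f, nat) trm \<Rightarrow> bool" where
  "antisymmetry M t \<longleftrightarrow>
     (\<forall>a \<in> carrier M. \<forall>b \<in> carrier M. op2 M t a b = b \<and> op2 M t b a = a \<longrightarrow> a = b)"

end

theory Submission
  imports Defs
begin

text \<open>
  Write \<open>x \<cdot> y\<close> for \<open>t(x, y)\<close> and \<open>x \<le> y\<close> for \<open>x \<cdot> y = y\<close>.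
  Right-absorption and flattening make \<open>p = x \<cdot> y\<close> and \<open>p \<cdot> y\<close> mutually comparable, so
  anti-symmetry yields \<open>p \<cdot> y = p = p \<cdot> p\<close>. With \<open>X = p \<cdot> x\<close>, weak closure stability then becomes
  \<open>X \<cdot> y \<le> X\<close>, while \<open>X \<le> X \<cdot> y\<close> holds by flattening, so \<open>X = X \<cdot> y\<close>.
  If moreover \<open>y \<le> x \<cdot> y\<close>, then flattening makes \<open>\<cdot>\<close> monotone in its left argument. Putting
  \<open>Y = (y \<cdot> x) \<cdot> y = Y \<cdot> x\<close>, one gets in turn \<open>x \<le> Y\<close>, \<open>x \<cdot> y \<le> Y \<cdot> y = Y\<close> and
  \<open>X \<le> Y \<cdot> x = Y\<close>; the Cornish condition follows by symmetry and anti-symmetry.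
\<close>

text \<open>The argument concerns one binary operation only, so it is detached from terms and
  derivations. Flattening is used throughout; the other equations are assumed where they
  enter.\<close>

locale flat_magma =
  fixes C :: "'a set" and m :: "'a \<Rightarrow> 'a \<Rightarrow> 'a" (infixl "\<cdot>" 70)
  assumes closed [simp]: "x \<in> C \<Longrightarrow> y \<in> C \<Longrightarrow> x \<cdot> y \<in> C"
    and flat: "x \<in> C \<Longrightarrow> y \<in> C \<Longrightarrow> z \<in> C \<Longrightarrow> (x \<cdot> y) \<cdot> (x \<cdot> z) = (x \<cdot> y) \<cdot> z"
begin

lemma antisymmetric_imp_stable:
  assumes right_abs: "\<And>x y. x \<in> C \<Longrightarrow> y \<in> C \<Longrightarrow> ((x \<cdot> y) \<cdot> y) \<cdot> (x \<cdot> y) = x \<cdot> y"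
    and weak_stab: "\<And>x y. x \<in> C \<Longrightarrow> y \<in> C \<Longrightarrow>
      ((((x \<cdot> y) \<cdot> x) \<cdot> (x \<cdot> y)) \<cdot> x) \<cdot> (((x \<cdot> y) \<cdot> x) \<cdot> x) = ((x \<cdot> y) \<cdot> x) \<cdot> x"
    and antisym: "\<And>x y. x \<in> C \<Longrightarrow> y \<in> C \<Longrightarrow> x \<cdot> y = y \<Longrightarrow> y \<cdot> x = x \<Longrightarrow> x = y"
    and x: "x \<in> C" and y: "y \<in> C"
  shows "(x \<cdot> y) \<cdot> x = ((x \<cdot> y) \<cdot> x) \<cdot> y"
proof -
  have square: "(u \<cdot> v) \<cdot> (u \<cdot> v) = u \<cdot> v" and absorb: "(u \<cdot> v) \<cdot> v = u \<cdot> v"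
    if u: "u \<in> C" and v: "v \<in> C" for u v
  proof -
    define p where "p = u \<cdot> v"
    have p: "p \<in> C" using u v by (simp add: p_def)
    have pv: "p \<cdot> p = p \<cdot> v" using flat[OF u v v] by (simp add: p_def)
    have down: "(p \<cdot> p) \<cdot> p = p" using right_abs[OF u v] pv by (simp add: p_def)
    \<comment> \<open>Right-absorption at \<open>p, p\<close> has left side
      \<open>((p \<cdot> p) \<cdot> p) \<cdot> (p \<cdot> p)\<close>, whose first factor is
      \<open>p\<close> by \<open>down\<close>.\<close>
    have "p \<cdot> (p \<cdot> p) = p \<cdot> p" using right_abs[OF p p] down by simp
    with down p have "p \<cdot> p = p" by (metis antisym closed)
    with pv show "(u \<cdot> v) \<cdot> (u \<cdot> v) = u \<cdot> v" "(u \<cdot> v) \<cdot> v = u \<cdot> v"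
      by (simp_all add: p_def)
  qed
  define p where "p = x \<cdot> y"
  define X where "X = p \<cdot> x"
  define b where "b = X \<cdot> y"
  have p: "p \<in> C" and X: "X \<in> C" and b: "b \<in> C"
    using x y by (simp_all add: p_def X_def b_def)
  have Xx: "X \<cdot> x = X" and XX: "X \<cdot> X = X"
    using absorb[OF p x] square[OF p x] by (simp_all add: X_def)
  have "X \<cdot> (p \<cdot> y) = X \<cdot> y" using flat[OF p x y] by (simp add: X_def)
  then have Xp: "X \<cdot> p = b" using absorb[OF x y] by (simp add: b_def p_def)
  have "b \<cdot> X = b \<cdot> x" using flat[OF X p x] Xx Xp by simp
  moreover have "(b \<cdot> x) \<cdot> X = X"
    using weak_stab[OF x y] Xx Xp by (simp add: X_def p_def)
  \<comment> \<open>Replacing \<open>b \<cdot> x\<close> by \<open>b \<cdot> X\<close> gives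
    \<open>(b \<cdot> X) \<cdot> X = X\<close>, and absorption removes the repeated
    \<open>X\<close>.\<close>
  ultimately have "b \<cdot> X = X" using absorb[OF b X] by simp
  moreover have "X \<cdot> b = b" using flat[OF X X y] XX by (simp add: b_def)
  ultimately have "X = b" by (metis antisym X b)
  then show ?thesis by (simp add: X_def b_def p_def)
qed

text \<open>Under the two comparisons the left side of the equation collapses to \<open>x\<close>
  and the right side to \<open>y\<close>.\<close>

lemma stable_imp_antisymmetric:
  assumes "(x \<cdot> y) \<cdot> x = ((x \<cdot> y) \<cdot> x) \<cdot> y" and "x \<cdot> y = y" and "y \<cdot> x = x"
  shows "x = y"
  using assms by metis

lemma stable_increasing_imp_cornish:
  assumes stable: "\<And>x y. x \<in> C \<Longrightarrow> y \<in> C \<Longrightarrow> (x \<cdot> y) \<cdot> x = ((x \<cdot> y) \<cdot> x) \<cdot> y"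
    and incr: "\<And>x y. x \<in> C \<Longrightarrow> y \<in> C \<Longrightarrow> y \<cdot> (x \<cdot> y) = x \<cdot> y"
    and x: "x \<in> C" and y: "y \<in> C"
  shows "(x \<cdot> y) \<cdot> x = (y \<cdot> x) \<cdot> y"
proof -
  \<comment> \<open>Without anti-symmetry at hand, \<open>incr\<close> is used twice to make
    \<open>u \<cdot> v\<close> idempotent; flattening turns its square into
    \<open>(u \<cdot> v) \<cdot> v\<close>.\<close>
  have absorb: "(u \<cdot> v) \<cdot> v = u \<cdot> v" if u: "u \<in> C" and v: "v \<in> C" for u v
    using incr[of v "u \<cdot> v"] incr[OF u v] flat[OF u v v] u v by simp
  have mono: "(u \<cdot> w) \<cdot> (v \<cdot> w) = v \<cdot> w"
    if u: "u \<in> C" and v: "v \<in> C" and w: "w \<in> C" and le: "u \<cdot> v = v" for u v w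
  proof -
    have "v \<cdot> (u \<cdot> w) = v \<cdot> w" using flat[OF u v w] le by simp
    \<comment> \<open>\<open>incr\<close> puts \<open>u \<cdot> w\<close> below
      \<open>v \<cdot> (u \<cdot> w)\<close>, which is \<open>v \<cdot> w\<close>.\<close>
    then show ?thesis using incr[of v "u \<cdot> w"] u v w by simp
  qed
  have le: "((u \<cdot> v) \<cdot> u) \<cdot> ((v \<cdot> u) \<cdot> v) = (v \<cdot> u) \<cdot> v"
    if u: "u \<in> C" and v: "v \<in> C" for u v
  proof -
    define Y where "Y = (v \<cdot> u) \<cdot> v"
    have Y: "Y \<in> C" using u v by (simp add: Y_def)
    have Yu: "Y \<cdot> u = Y" using stable[OF v u, symmetric] by (simp add: Y_def)
    have Yv: "Y \<cdot> v = Y" using absorb[of "v \<cdot> u" v] u v by (simp add: Y_def)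
    have "u \<cdot> Y = Y" using incr[OF Y u] Yu by simp
    then have "(u \<cdot> v) \<cdot> Y = Y" using mono[OF u Y v] Yv by simp
    then have "((u \<cdot> v) \<cdot> u) \<cdot> Y = Y" using mono[of "u \<cdot> v" Y u] Yu u v Y by simp
    then show ?thesis by (simp add: Y_def)
  qed
  show ?thesis
    by (rule stable_imp_antisymmetric[OF stable le le]) (simp_all add: x y)
qed

end

lemma eval_trm_in_carrier:
  assumes "is_term \<Sigma> s" and "is_algebra \<Sigma> M" and "\<And>v. \<alpha> v \<in> carrier M"
  shows "eval_trm M \<alpha> s \<in> carrier M"
  using assms(1)
proof induction
  case (1 v)
  then show ?case using assms(3) by simp
next
  case (2 f ts)
  then have "set (map (eval_trm M \<alpha>) ts) \<subseteq> carrier M" by auto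
  with 2(1) assms(2) show ?case
    unfolding is_algebra_def by fastforce
qed

lemma eval_trm_subst: "eval_trm M \<alpha> (subst \<theta> s) = eval_trm M (\<lambda>v. eval_trm M \<alpha> (\<theta> v)) s"
  by (induction s) (simp_all cong: map_cong)

lemma eval_trm_papp: "eval_trm M \<alpha> (papp t u w) = op2 M t (eval_trm M \<alpha> u) (eval_trm M \<alpha> w)"
  unfolding papp_def op2_def eval_trm_subst by (rule arg_cong[where f = "\<lambda>\<beta>. eval_trm M \<beta> t"]) auto

text \<open>Soundness of equational logic, which carries the three provable equations over to
  \<open>M\<close>.\<close>

lemma proves_sound:
  assumes "proves \<Sigma> T e" and "theory_algebra \<Sigma> T M"
  shows "satisfies M e"
  using assms(1)
proof induction
  case (axiom s t)
  then show ?case using assms(2) by (simp add: theory_algebra_def)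
next
  case (cong f ss ts)
  then have "map (eval_trm M \<alpha>) ss = map (eval_trm M \<alpha>) ts" if "\<And>v. \<alpha> v \<in> carrier M" for \<alpha>
    using that by (intro nth_equalityI) (auto simp: satisfies_def)
  then show ?case by (simp add: satisfies_def)
next
  case (subst s t \<theta>)
  have "eval_trm M \<alpha> (\<theta> v) \<in> carrier M" if "\<And>v. \<alpha> v \<in> carrier M" for \<alpha> v
    using eval_trm_in_carrier subst.hyps(2) assms(2) that by (metis theory_algebra_def)
  then show ?case using subst.IH by (simp add: satisfies_def eval_trm_subst)
qed (simp_all add: satisfies_def)

text \<open>Assignments are total, so \<open>c\<close> also fills all variables beyond 2. For
  equations in two variables, \<open>b\<close> can be repeated as \<open>c\<close>.\<close>

lemma satisfiesD:
  assumes "satisfies M e" and "a \<in> carrier M" and "b \<in> carrier M" and "c \<in> carrier M"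
  defines "\<alpha> \<equiv> \<lambda>v::nat. if v = 0 then a else if v = 1 then b else c"
  shows "eval_trm M \<alpha> (fst e) = eval_trm M \<alpha> (snd e)"
  using assms by (simp add: satisfies_def)

theorem mainTheorem3:
  fixes \<Sigma> :: "'f signature" and T :: "'f eqn set" and t :: "('f, nat) trm"
    and M :: "('f, 'a) algebra"
  assumes "algebraic_theory \<Sigma> T"
    and "weak_relative_closure_term \<Sigma> T t"
    and "theory_algebra \<Sigma> T M"
  shows "(antisymmetry M t \<longleftrightarrow>
            satisfies M (papp t (papp t vx vy) vx, papp t (papp t (papp t vx vy) vx) vy))
       \<and> (satisfies M (papp t (papp t vx vy) vx, papp t (papp t (papp t vx vy) vx) vy)
            \<and> satisfies M (le_eqn t vy (papp t vx vy))
          \<longrightarrow> satisfies M (papp t (papp t vx vy) vx, papp t (papp t vy vx) vy))"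
proof -
  let ?C = "carrier M" and ?m = "op2 M t"
  note eqn_simps = Let_def le_eqn_def eval_trm_papp
  have R: "satisfies M (right_absorption t)" and F: "satisfies M (flattening t)"
    and W: "satisfies M (weak_closure_stability t)"
    using assms(2) proves_sound[OF _ assms(3)] by (auto simp: weak_relative_closure_term_def)
  interpret flat_magma ?C ?m
  proof
    show "?m x y \<in> ?C" if "x \<in> ?C" "y \<in> ?C" for x y
      using that assms(2,3) unfolding op2_def
      by (intro eval_trm_in_carrier[of \<Sigma>])
        (auto simp: weak_relative_closure_term_def binary_term_def theory_algebra_def)
    show "?m (?m x y) (?m x z) = ?m (?m x y) z" if "x \<in> ?C" "y \<in> ?C" "z \<in> ?C" for x y z
      using satisfiesD[OF F that] by (simp add: flattening_def eqn_simps)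
  qed
  let ?stable = "satisfies M (papp t (papp t vx vy) vx, papp t (papp t (papp t vx vy) vx) vy)"
  have stableD: "?m (?m x y) x = ?m (?m (?m x y) x) y"
    if "?stable" "x \<in> ?C" "y \<in> ?C" for x y
    using satisfiesD[OF that that(3), symmetric] by (simp add: eqn_simps)
  have "?stable" if anti: "antisymmetry M t"
  proof -
    \<comment> \<open>The longer side stands on the left so that rewriting terminates: it contains
      the shorter side.\<close>
    have "?m (?m (?m x y) x) y = ?m (?m x y) x" if "x \<in> ?C" "y \<in> ?C" for x y
    proof (rule antisymmetric_imp_stable[OF _ _ _ that, symmetric])
      fix x y assume xy: "x \<in> ?C" "y \<in> ?C"
      show "?m (?m (?m x y) y) (?m x y) = ?m x y"
        using satisfiesD[OF R xy xy(2)] by (simp add: right_absorption_def eqn_simps)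
      show "?m (?m (?m (?m (?m x y) x) (?m x y)) x) (?m (?m (?m x y) x) x) = ?m (?m (?m x y) x) x"
        using satisfiesD[OF W xy xy(2)] by (simp add: weak_closure_stability_def eqn_simps)
      show "?m x y = y \<Longrightarrow> ?m y x = x \<Longrightarrow> x = y"
        using anti xy unfolding antisymmetry_def by blast
    qed
    then show ?thesis by (simp add: satisfies_def eqn_simps)
  qed
  moreover have "antisymmetry M t" if "?stable"
    using stable_imp_antisymmetric stableD[OF that] unfolding antisymmetry_def by blast
  moreover have "satisfies M (papp t (papp t vx vy) vx, papp t (papp t vy vx) vy)"
    if "?stable" and incr: "satisfies M (le_eqn t vy (papp t vx vy))"
  proof -
    have "?m y (?m x y) = ?m x y" if "x \<in> ?C" "y \<in> ?C" for x y
      using satisfiesD[OF incr that that(2)] by (simp add: eqn_simps)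
    then have "?m (?m x y) x = ?m (?m y x) y" if "x \<in> ?C" "y \<in> ?C" for x y
      using stable_increasing_imp_cornish[OF stableD[OF \<open>?stable\<close>]] that by blast
    then show ?thesis by (simp add: satisfies_def eqn_simps)
  qed
  ultimately show ?thesis by blast
qed

end
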